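(* Let $\mathfrak{g}=A_{5,2}$ and let $\langle\cdot,\cdot\rangle$ be an inner product on $\mathfrak{g}$. Let $\eta>0$ and let $\{v_1,\dots,v_5\}$ be a basis of $\mathfrak{g}$, orthonormal with respect to $\eta\langle\cdot,\cdot\rangle$, whose only nonzero brackets (up to antisymmetry) are $[v_1,v_2]=\alpha v_3+\beta v_4$, $[v_1,v_3]=\gamma v_4$, $[v_1,v_4]=\delta v_5$, with $\alpha,\gamma,\delta>0$ and $\beta\in\mathbb{R}$. Then $\langle\cdot,\cdot\rangle$ is a nilsoliton if and only if $\beta=0$ and $\alpha=\delta=\frac{\sqrt{3}}{2}\gamma$.
   Context: $A_{5,2}$ is the five-dimensional real nilpotent Lie algebra having a basis with the brackets displayed in the claim. An inner product on $\mathfrak{g}$ is identified with the left-invariant Riemannian metric $g$ it induces on the simply connected Lie group $G$ with Lie algebra $\mathfrak{g}$. Let $ric_g$ be the Ricci curvature tensor of $(G,g)$ (Levi-Civita connection), viewed as a symmetric bilinear form on $\mathfrak{g}$; since $\mathfrak{g}$ is nilpotent, $ric_g(u,v)=-\frac12\mathrm{tr}(ad_u\circ ad_v^* )-\frac14\mathrm{tr}(J_u\circ J_v)$, where $ad_uv=[u,v]$, $ad_v^*$ is the $g$-transpose of $ad_v$, and $J_uv=ad_v^*u$. The Ricci operator $Ric_g$ is defined by $ric_g(u,v)=g(Ric_g(u),v)$. The metric $g$ is a nilsoliton if $Ric_g\in\mathbb{R}\,\mathrm{Id}_{\mathfrak{g}}\oplus Der(\mathfrak{g})$, i.e. $Ric_g=c\,\mathrm{Id}+D$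 for some $c\in\mathbb{R}$ and some derivation $D$ of $\mathfrak{g}$. *)

theory Defs
  imports "HOL-Analysis.Analysis"
begin

section \<open>Lie algebras\<close>

text \<open>
  The carrier of a finite-dimensional real Lie algebra is a type of class
  \<^class>\<open>euclidean_space\<close>. Its built-in inner product plays no role: it serves only to
  evaluate traces, which do not depend on it. The inner product under consideration is
  always an explicit bilinear form \<open>g\<close>.
\<close>

definition lie_algebra :: "('a::real_vector \<Rightarrow> 'a \<Rightarrow> 'a) \<Rightarrow> bool" where
  "lie_algebra br \<longleftrightarrow> bilinear br \<and> (\<forall>x. br x x = 0) \<and>
     (\<forall>x y z. br x (br y z) + br y (br z x) + br z (br x y) = 0)"

definition derivation :: "('a::real_vector \<Rightarrow> 'a \<Rightarrow> 'a) \<Rightarrow> ('a \<Rightarrow> 'a) \<Rightarrow> bool" where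
  "derivation br D \<longleftrightarrow> linear D \<and> (\<forall>x y. D (br x y) = br (D x) y + br x (D y))"

fun lower_central :: "('a::real_vector \<Rightarrow> 'a \<Rightarrow> 'a) \<Rightarrow> nat \<Rightarrow> 'a set" where
  "lower_central br 0 = UNIV"
| "lower_central br (Suc n) = span {br x y |x y. y \<in> lower_central br n}"

definition nilpotent_lie :: "('a::real_vector \<Rightarrow> 'a \<Rightarrow> 'a) \<Rightarrow> bool" where
  "nilpotent_lie br \<longleftrightarrow> lie_algebra br \<and> (\<exists>n. lower_central br n = {0})"

definition basis5 :: "(nat \<Rightarrow> 'a::real_vector) \<Rightarrow> bool" where
  "basis5 v \<longleftrightarrow> inj_on v {1..5} \<and> independent (v ` {1..5}) \<and> span (v ` {1..5}) = UNIV"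

definition A52_brackets ::
    "('a::real_vector \<Rightarrow> 'a \<Rightarrow> 'a) \<Rightarrow> (nat \<Rightarrow> 'a) \<Rightarrow> real \<Rightarrow> real \<Rightarrow> real \<Rightarrow> real \<Rightarrow> bool" where
  "A52_brackets br v \<alpha> \<beta> \<gamma> \<delta> \<longleftrightarrow>
     br (v 1) (v 2) = \<alpha> *\<^sub>R v 3 + \<beta> *\<^sub>R v 4 \<and>
     br (v 1) (v 3) = \<gamma> *\<^sub>R v 4 \<and>
     br (v 1) (v 4) = \<delta> *\<^sub>R v 5 \<and>
     br (v 1) (v 5) = 0 \<and>
     (\<forall>i\<in>{2..5}. \<forall>j\<in>{2..5}. br (v i) (v j) = 0)"

text \<open>
  The isomorphism type is fixed by the normal form \<open>\<alpha> = \<gamma> = \<delta> = 1\<close>, \<open>\<beta> = 0\<close>; any other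
  choice with \<open>\<alpha>\<close>, \<open>\<gamma>\<close>, \<open>\<delta>\<close> positive gives the same Lie algebra (lemma \<open>A52I\<close> below).
\<close>

definition A52 :: "('a::real_vector \<Rightarrow> 'a \<Rightarrow> 'a) \<Rightarrow> bool" where
  "A52 br \<longleftrightarrow> lie_algebra br \<and> (\<exists>e. basis5 e \<and> A52_brackets br e 1 0 1 1)"


section \<open>Left-invariant metrics\<close>

definition inner_product :: "('a::real_vector \<Rightarrow> 'a \<Rightarrow> real) \<Rightarrow> bool" where
  "inner_product g \<longleftrightarrow> bilinear g \<and> (\<forall>x y. g x y = g y x) \<and> (\<forall>x. x \<noteq> 0 \<longrightarrow> 0 < g x x)"

definition tr :: "('a::euclidean_space \<Rightarrow> 'a) \<Rightarrow> real" where
  "tr f = (\<Sum>b\<in>Basis. f b \<bullet> b)"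

text \<open>
  Left-invariant vector fields are identified with elements of the Lie algebra. For them
  \<open>g(Y, Z)\<close> is constant, so metric compatibility reads
  \<open>g(\<nabla>\<^sub>X Y, Z) + g(Y, \<nabla>\<^sub>X Z) = 0\<close>. As they span every tangent space, the resulting product on
  the Lie algebra determines the Levi-Civita connection and its (left-invariant) curvature.
\<close>

definition levi_civita ::
    "('a::real_vector \<Rightarrow> 'a \<Rightarrow> 'a) \<Rightarrow> ('a \<Rightarrow> 'a \<Rightarrow> real) \<Rightarrow> 'a \<Rightarrow> 'a \<Rightarrow> 'a" where
  "levi_civita br g = (THE N. bilinear N \<and>
     (\<forall>x y. N x y - N y x = br x y) \<and>
     (\<forall>x y z. g (N x y) z + g y (N x z) = 0))"

definition curvature ::
    "('a::real_vector \<Rightarrow> 'a \<Rightarrow> 'a) \<Rightarrow> ('a \<Rightarrow> 'a \<Rightarrow> real) \<Rightarrow> 'a \<Rightarrow> 'a \<Rightarrow> 'a \<Rightarrow> 'a" where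
  "curvature br g x y z =
     (let N = levi_civita br g in N x (N y z) - N y (N x z) - N (br x y) z)"

definition ricci ::
    "('a::euclidean_space \<Rightarrow> 'a \<Rightarrow> 'a) \<Rightarrow> ('a \<Rightarrow> 'a \<Rightarrow> real) \<Rightarrow> 'a \<Rightarrow> 'a \<Rightarrow> real" where
  "ricci br g u v = tr (\<lambda>w. curvature br g w u v)"

definition ricci_op ::
    "('a::euclidean_space \<Rightarrow> 'a \<Rightarrow> 'a) \<Rightarrow> ('a \<Rightarrow> 'a \<Rightarrow> real) \<Rightarrow> 'a \<Rightarrow> 'a" where
  "ricci_op br g u = (THE w. \<forall>v. ricci br g u v = g w v)"

definition nilsoliton ::
    "('a::euclidean_space \<Rightarrow> 'a \<Rightarrow> 'a) \<Rightarrow> ('a \<Rightarrow> 'a \<Rightarrow> real) \<Rightarrow> bool" where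
  "nilsoliton br g \<longleftrightarrow> (\<exists>c D. derivation br D \<and> (\<forall>u. ricci_op br g u = c *\<^sub>R u + D u))"


section \<open>Well-definedness of the notions above\<close>

lemma basis5_DIM:
  fixes v :: "nat \<Rightarrow> 'a::euclidean_space"
  assumes "basis5 v"
  shows "DIM('a) = 5"
proof -
  have "dim (v ` {1..5}) = card (v ` {1..5})"
    using assms dim_eq_card_independent unfolding basis5_def by blast
  moreover have "card (v ` {1..5}) = 5"
    using assms by (simp add: basis5_def card_image)
  ultimately show ?thesis
    using assms by (metis basis5_def dim_UNIV dim_span)
qed

lemma set15: "{1..5::nat} = {1,2,3,4,5}" "{2..5::nat} = {2,3,4,5}"
  by auto

lemma A52I:
  fixes br :: "'a::euclidean_space \<Rightarrow> 'a \<Rightarrow> 'a"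
  assumes lie: "lie_algebra br" and v: "basis5 v" and b: "A52_brackets br v \<alpha> \<beta> \<gamma> \<delta>"
    and pos: "\<alpha> > 0" "\<gamma> > 0" "\<delta> > 0"
  shows "A52 br"
proof -
  have bil: "bilinear br" using lie by (simp add: lie_algebra_def)
  note br_simps = bilinear_ladd[OF bil] bilinear_radd[OF bil] bilinear_lmul[OF bil]
    bilinear_rmul[OF bil] bilinear_rzero[OF bil]
  define e :: "nat \<Rightarrow> 'a" where "e = v(3 := \<alpha> *\<^sub>R v 3 + \<beta> *\<^sub>R v 4,
     4 := (\<alpha> * \<gamma>) *\<^sub>R v 4 + (\<beta> * \<delta>) *\<^sub>R v 5, 5 := (\<alpha> * \<gamma> * \<delta>) *\<^sub>R v 5)"
  have e: "e 1 = v 1" "e 2 = v 2" "e 3 = \<alpha> *\<^sub>R v 3 + \<beta> *\<^sub>R v 4"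
    "e 4 = (\<alpha> * \<gamma>) *\<^sub>R v 4 + (\<beta> * \<delta>) *\<^sub>R v 5" "e 5 = (\<alpha> * \<gamma> * \<delta>) *\<^sub>R v 5"
    by (simp_all add: e_def)
  have tab: "A52_brackets br e 1 0 1 1"
    using b unfolding A52_brackets_def set15
    by (simp add: e[unfolded One_nat_def] br_simps mult.commute)
  let ?S = "span (e ` {1..5})"
  have eS: "e i \<in> ?S" if "i \<in> {1..5}" for i
    using that by (auto intro: span_base)
  have v5: "v 5 \<in> ?S"
    using span_scale[OF eS[of 5], of "1 / (\<alpha> * \<gamma> * \<delta>)"] pos by (simp add: e)
  have "v 4 = (1 / (\<alpha> * \<gamma>)) *\<^sub>R (e 4 - (\<beta> * \<delta>) *\<^sub>R v 5)"
    using pos by (simp add: e)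
  then have v4: "v 4 \<in> ?S"
    using eS[of 4] v5 by (simp add: span_diff span_scale)
  have "v 3 = (1 / \<alpha>) *\<^sub>R (e 3 - \<beta> *\<^sub>R v 4)"
    using pos by (simp add: e)
  then have v3: "v 3 \<in> ?S"
    using eS[of 3] v4 by (simp add: span_diff span_scale)
  have "v ` {1..5} \<subseteq> ?S"
    using v3 v4 v5 eS[of 1] eS[of 2] e(1,2) unfolding set15 by auto
  then have "span (v ` {1..5}) \<subseteq> ?S"
    by (simp add: span_minimal)
  then have sp: "?S = UNIV"
    using v by (auto simp: basis5_def)
  have "DIM('a) = 5" using basis5_DIM[OF v] .
  then have dim5: "dim (e ` {1..5}) = 5"
    by (metis dim_UNIV dim_span sp)
  have card: "card (e ` {1..5}) = 5"
    using card_image_le[of "{1..5}" e] dim_le_card[OF span_superset, of "e ` {1..5}"] dim5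
    by simp
  then have "inj_on e {1..5}"
    by (intro eq_card_imp_inj_on) auto
  moreover have "independent (e ` {1..5})"
    by (rule card_le_dim_spanning[of _ UNIV])
      (use sp card \<open>DIM('a) = 5\<close> in \<open>auto simp: dim_UNIV\<close>)
  ultimately have "basis5 e" using sp by (simp add: basis5_def)
  then show ?thesis using lie tab by (auto simp: A52_def)
qed

lemma A52_nilpotent:
  assumes "A52 br"
  shows "nilpotent_lie br"
proof -
  from assms obtain e where lie: "lie_algebra br" and e: "basis5 e"
    and b: "A52_brackets br e 1 0 1 1"
    by (auto simp: A52_def)
  have bil: "bilinear br" using lie by (simp add: lie_algebra_def)
  have alt: "br x y = - br y x" for x y
  proof -
    have "br (x + y) (x + y) = 0" "br x x = 0" "br y y = 0"
      using lie by (auto simp: lie_algebra_def)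
    then show ?thesis
      by (simp add: bilinear_ladd[OF bil] bilinear_radd[OF bil] add_eq_0_iff)
  qed
  have step: "lower_central br (Suc n) \<subseteq> span T"
    if S: "lower_central br n \<subseteq> span S"
      and T: "\<And>i s. i \<in> {1..5} \<Longrightarrow> s \<in> S \<Longrightarrow> br (e i) s \<in> span T" for n S T
  proof -
    have "br x y \<in> span T" if y: "y \<in> lower_central br n" for x y
    proof -
      have 1: "br x s \<in> span T" if "s \<in> S" for s
      proof -
        have "x \<in> span (e ` {1..5})" using e by (simp add: basis5_def)
        then show ?thesis
          by (induction rule: span_induct_alt)
            (use T that in \<open>auto simp: bilinear_lzero[OF bil] bilinear_ladd[OF bil]
              bilinear_lmul[OF bil] span_zero intro!: span_add span_scale\<close>)
      qed
      have "y \<in> span S" using y S by auto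
      then show ?thesis
        by (induction rule: span_induct_alt)
          (use 1 in \<open>auto simp: bilinear_rzero[OF bil] bilinear_radd[OF bil]
            bilinear_rmul[OF bil] span_zero intro!: span_add span_scale\<close>)
    qed
    then have "{br x y |x y. y \<in> lower_central br n} \<subseteq> span T" by auto
    then show ?thesis
      by (simp add: span_minimal)
  qed
  have z: "br (e 1) (e 1) = 0" using lie by (simp add: lie_algebra_def)
  have br1: "br (e 2) (e 1) = - e 3" "br (e 3) (e 1) = - e 4" "br (e 4) (e 1) = - e 5"
    "br (e 5) (e 1) = 0"
    using b alt[of "e 2" "e 1"] alt[of "e 3" "e 1"] alt[of "e 4" "e 1"] alt[of "e 5" "e 1"]
    by (simp_all add: A52_brackets_def)
  note tab = b[unfolded A52_brackets_def set15, simplified] z[simplified] br1[simplified]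
  have L0: "lower_central br 0 \<subseteq> span (e ` {1..5})"
    using e by (simp add: basis5_def)
  have L1: "lower_central br (Suc 0) \<subseteq> span {e 3, e 4, e 5}"
    by (rule step[OF L0]) (auto simp: set15[unfolded One_nat_def] tab span_zero span_neg span_base)
  have L2: "lower_central br (Suc (Suc 0)) \<subseteq> span {e 4, e 5}"
    by (rule step[OF L1]) (auto simp: set15[unfolded One_nat_def] tab span_zero span_base)
  have L3: "lower_central br (Suc (Suc (Suc 0))) \<subseteq> span {e 5}"
    by (rule step[OF L2]) (auto simp: set15[unfolded One_nat_def] tab span_zero span_base)
  have L4: "lower_central br (Suc (Suc (Suc (Suc 0)))) \<subseteq> span {}"
    by (rule step[OF L3]) (auto simp: set15[unfolded One_nat_def] tab span_zero span_base)
  then have "lower_central br (Suc (Suc (Suc (Suc 0)))) = {0}"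
    by (auto simp: span_zero)
  then show ?thesis
    using lie unfolding nilpotent_lie_def by blast
qed

text \<open>\<open>ad_star br g v\<close> is the \<open>g\<close>-transpose \<open>ad\<^sub>v\<^sup>*\<close> of \<open>ad\<^sub>v = br v\<close>.\<close>

definition ad_star ::
    "('a::real_vector \<Rightarrow> 'a \<Rightarrow> 'a) \<Rightarrow> ('a \<Rightarrow> 'a \<Rightarrow> real) \<Rightarrow> 'a \<Rightarrow> 'a \<Rightarrow> 'a" where
  "ad_star br g v = (THE h. \<forall>x y. g (h x) y = g x (br v y))"

lemma riesz:
  fixes g :: "'a::euclidean_space \<Rightarrow> 'a \<Rightarrow> real"
  assumes g: "inner_product g" and f: "linear f"
  shows "\<exists>!w. \<forall>y. f y = g w y"
proof -
  have bil: "bilinear g" using g by (simp add: inner_product_def)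
  define G where "G x = (\<Sum>b\<in>Basis. g x b *\<^sub>R b)" for x
  have expand: "h y = (\<Sum>b\<in>Basis. h b *\<^sub>R b) \<bullet> y" if "linear h" for h :: "'a \<Rightarrow> real" and y
  proof -
    have "h y = h (\<Sum>b\<in>Basis. (y \<bullet> b) *\<^sub>R b)" by (simp add: euclidean_representation)
    also have "\<dots> = (\<Sum>b\<in>Basis. (y \<bullet> b) *\<^sub>R h b)"
      by (simp only: linear_sum[OF that] linear_scale[OF that])
    finally show ?thesis
      by (simp add: inner_sum_left mult.commute inner_commute[of y])
  qed
  have G: "g x y = G x \<bullet> y" for x y
    unfolding G_def by (rule expand) (use bil in \<open>simp add: bilinear_def\<close>)
  have lin: "linear G"
    by (rule linearI)
      (simp_all add: G_def bilinear_ladd[OF bil] bilinear_lmul[OF bil] scaleR_add_left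
        sum.distrib scaleR_sum_right)
  have "x = 0" if "G x = 0" for x
    using that g G[of x x] by (auto simp: inner_product_def)
  then have inj: "inj G" using linear_injective_0[OF lin] by blast
  then obtain w where w: "G w = (\<Sum>b\<in>Basis. f b *\<^sub>R b)"
    using linear_injective_imp_surjective[OF lin] by (metis surjD)
  have "\<forall>y. f y = g w y" by (simp add: G w expand[OF f, symmetric])
  moreover have "w' = w" if "\<forall>y. f y = g w' y" for w'
  proof -
    have "G w' \<bullet> y = G w \<bullet> y" for y using that calculation G by metis
    then have "G w' = G w" by (metis vector_eq_rdot)
    then show ?thesis using inj by (simp add: inj_eq)
  qed
  ultimately show ?thesis by blast
qed

lemma inner_product_cancel:
  assumes g: "inner_product g" and "\<And>y. g a y = g b y"
  shows "a = b"
proof (rule ccontr)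
  assume "a \<noteq> b"
  then have "g (a - b) (a - b) > 0" using g by (simp add: inner_product_def)
  moreover have "g (a - b) (a - b) = g a (a - b) - g b (a - b)"
    using g by (simp add: inner_product_def bilinear_lsub)
  ultimately show False using assms(2) by simp
qed

lemma adjoint_exists:
  fixes g :: "'a::euclidean_space \<Rightarrow> 'a \<Rightarrow> real"
  assumes g: "inner_product g" and f: "linear f"
  shows "\<exists>!h. \<forall>x y. g (h x) y = g x (f y)"
proof -
  have ex: "\<exists>!w. \<forall>y. g x (f y) = g w y" for x
  proof (rule riesz[OF g])
    have "linear (g x)" using g by (simp add: inner_product_def bilinear_def)
    from linear_compose[OF f this] show "linear (\<lambda>y. g x (f y))" by (simp add: o_def)
  qed
  define h where "h x = (THE w. \<forall>y. g x (f y) = g w y)" for x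
  have h: "g (h x) y = g x (f y)" for x y
    unfolding h_def by (rule theI'[OF ex, THEN spec, symmetric])
  show ?thesis
  proof (rule ex1I[of _ h])
    fix k assume k: "\<forall>x y. g (k x) y = g x (f y)"
    show "k = h"
    proof
      show "k x = h x" for x
        by (rule inner_product_cancel[OF g]) (simp only: h k)
    qed
  qed (simp only: h, simp)
qed

lemma ad_star:
  fixes g :: "'a::euclidean_space \<Rightarrow> 'a \<Rightarrow> real"
  assumes "inner_product g" and "lie_algebra br"
  shows "g (ad_star br g v x) y = g x (br v y)"
proof -
  have "linear (br v)" using assms by (simp add: lie_algebra_def bilinear_def)
  from theI'[OF adjoint_exists[OF assms(1) this]] show ?thesis
    unfolding ad_star_def by blast
qed

lemma lie_anticomm:
  assumes "lie_algebra br"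
  shows "br x y = - br y x"
proof -
  have bil: "bilinear br" using assms by (simp add: lie_algebra_def)
  have "br (x + y) (x + y) = 0" "br x x = 0" "br y y = 0"
    using assms by (auto simp: lie_algebra_def)
  then show ?thesis
    by (simp add: bilinear_ladd[OF bil] bilinear_radd[OF bil] add_eq_0_iff)
qed

lemma bilinear_ad_star:
  fixes g :: "'a::euclidean_space \<Rightarrow> 'a \<Rightarrow> real"
  assumes g: "inner_product g" and l: "lie_algebra br"
  shows "bilinear (ad_star br g)"
proof -
  have bg: "bilinear g" using g by (simp add: inner_product_def)
  have bb: "bilinear br" using l by (simp add: lie_algebra_def)
  note simps = ad_star[OF g l] bilinear_ladd[OF bg] bilinear_radd[OF bg] bilinear_lmul[OF bg]
    bilinear_rmul[OF bg] bilinear_ladd[OF bb] bilinear_lmul[OF bb]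
  show ?thesis
    unfolding bilinear_def linear_iff
    by (intro conjI allI; rule inner_product_cancel[OF g]; simp add: simps)
qed

text \<open>The Koszul formula.\<close>

lemma levi_civita:
  fixes g :: "'a::euclidean_space \<Rightarrow> 'a \<Rightarrow> real"
  assumes g: "inner_product g" and l: "lie_algebra br"
  shows "levi_civita br g =
    (\<lambda>x y. (1/2) *\<^sub>R (br x y - ad_star br g y x - ad_star br g x y))" (is "_ = ?N")
  unfolding levi_civita_def
proof (rule the_equality)
  have bg: "bilinear g" using g by (simp add: inner_product_def)
  have sym: "g x y = g y x" for x y using g by (simp add: inner_product_def)
  have bb: "bilinear br" using l by (simp add: lie_algebra_def)
  note ac = lie_anticomm[OF l]
  note gs = bilinear_lsub[OF bg] bilinear_rsub[OF bg] bilinear_lmul[OF bg] bilinear_rmul[OF bg]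
    bilinear_lneg[OF bg] bilinear_rneg[OF bg] ad_star[OF g l]
  have ba: "bilinear (ad_star br g)" by (rule bilinear_ad_star[OF g l])
  have N2: "2 * g (?N x y) z = g (br x y) z - g x (br y z) - g y (br x z)" for x y z
    by (simp add: gs)
  show "bilinear ?N \<and> (\<forall>x y. ?N x y - ?N y x = br x y) \<and>
      (\<forall>x y z. g (?N x y) z + g y (?N x z) = 0)"
  proof (intro conjI allI)
    show "bilinear ?N"
      unfolding bilinear_def linear_iff
      by (simp add: bilinear_ladd[OF bb] bilinear_radd[OF bb] bilinear_lmul[OF bb]
        bilinear_rmul[OF bb] bilinear_ladd[OF ba] bilinear_radd[OF ba] bilinear_lmul[OF ba]
        bilinear_rmul[OF ba] algebra_simps)
    show "?N x y - ?N y x = br x y" for x y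
    proof -
      have "?N x y - ?N y x = (1/2) *\<^sub>R (br x y - br y x)" by (simp add: algebra_simps)
      also have "\<dots> = br x y" using ac[of y x] by (simp flip: scaleR_2)
      finally show ?thesis .
    qed
    show "g (?N x y) z + g y (?N x z) = 0" for x y z
    proof -
      have "2 * g (?N x y) z + 2 * g (?N x z) y = 0"
        unfolding N2
        using ac[of z y] sym[of "br x y" z] sym[of "br x z" y] by (simp add: gs)
      then show ?thesis using sym[of y "?N x z"] by simp
    qed
  qed
  fix N
  assume N: "bilinear N \<and> (\<forall>x y. N x y - N y x = br x y) \<and>
      (\<forall>x y z. g (N x y) z + g y (N x z) = 0)"
  have tor: "g (br x y) z = g (N x y) z - g (N y x) z" for x y z
    using N bilinear_lsub[OF bg] by metis
  have met: "g (N x y) z = - g (N x z) y" for x y z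
    using N sym[of y "N x z"] by (simp add: add_eq_0_iff)
  have K: "2 * g (N x y) z = g (br x y) z - g x (br y z) - g y (br x z)" for x y z
    unfolding sym[of x "br y z"] sym[of y "br x z"] tor
    using met[of x y z] met[of y x z] met[of z x y] by simp
  then have "g (N x y) z = g (?N x y) z" for x y z
    using K[of x y z] N2[of x y z] by linarith
  then show "N = ?N"
    using inner_product_cancel[OF g] by (intro ext) blast
qed

lemma tr_add: "tr (\<lambda>x. f x + h x) = tr f + tr h"
  by (simp add: tr_def inner_add_left sum.distrib)

lemma tr_diff: "tr (\<lambda>x. f x - h x) = tr f - tr h"
  by (simp add: tr_def inner_diff_left sum_subtractf)

lemma tr_scale: "tr (\<lambda>x. c *\<^sub>R f x) = c * tr f"
  by (simp add: tr_def sum_distrib_left)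

lemma tr_comm:
  fixes f h :: "'a::euclidean_space \<Rightarrow> 'a"
  assumes f: "linear f" and h: "linear h"
  shows "tr (\<lambda>x. f (h x)) = tr (\<lambda>x. h (f x))"
proof -
  have ex: "f (h b) \<bullet> b = (\<Sum>c\<in>Basis. (h b \<bullet> c) * (f c \<bullet> b))"
    if "linear f" for f h :: "'a \<Rightarrow> 'a" and b
  proof -
    have "f (h b) = f (\<Sum>c\<in>Basis. (h b \<bullet> c) *\<^sub>R c)" by (simp add: euclidean_representation)
    also have "\<dots> = (\<Sum>c\<in>Basis. (h b \<bullet> c) *\<^sub>R f c)"
      by (simp only: linear_sum[OF that] linear_scale[OF that])
    finally show ?thesis by (simp add: inner_sum_left)
  qed
  have "tr (\<lambda>x. f (h x)) = (\<Sum>b\<in>Basis. \<Sum>c\<in>Basis. (h b \<bullet> c) * (f c \<bullet> b))"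
    unfolding tr_def by (intro sum.cong refl ex[OF f])
  also have "\<dots> = (\<Sum>c\<in>Basis. \<Sum>b\<in>Basis. (f c \<bullet> b) * (h b \<bullet> c))"
    by (subst sum.swap) (simp add: mult.commute)
  also have "\<dots> = tr (\<lambda>x. h (f x))"
    unfolding tr_def by (intro sum.cong refl ex[OF h, symmetric])
  finally show ?thesis .
qed

lemma ricci_op:
  fixes g :: "'a::euclidean_space \<Rightarrow> 'a \<Rightarrow> real"
  assumes g: "inner_product g" and l: "lie_algebra br"
  shows "ricci br g u v = g (ricci_op br g u) v"
proof -
  have bb: "bilinear br" using l by (simp add: lie_algebra_def)
  have ba: "bilinear (ad_star br g)" by (rule bilinear_ad_star[OF g l])
  have bN: "bilinear (levi_civita br g)"
    unfolding levi_civita[OF g l] bilinear_def linear_iff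
    by (simp add: bilinear_ladd[OF bb] bilinear_radd[OF bb] bilinear_lmul[OF bb]
      bilinear_rmul[OF bb] bilinear_ladd[OF ba] bilinear_radd[OF ba] bilinear_lmul[OF ba]
      bilinear_rmul[OF ba] algebra_simps)
  have "linear (curvature br g w u)" for w
    unfolding curvature_def Let_def linear_iff
    by (simp add: bilinear_radd[OF bN] bilinear_rmul[OF bN] algebra_simps)
  then have "linear (ricci br g u)"
    unfolding ricci_def linear_iff by (simp add: tr_add tr_scale)
  from theI'[OF riesz[OF g this]] show ?thesis
    unfolding ricci_op_def by blast
qed

lemma tr_g_adjoint:
  fixes g :: "'a::euclidean_space \<Rightarrow> 'a \<Rightarrow> real"
  assumes g: "inner_product g" and f: "linear f" and h: "linear h"
    and a: "\<And>x y. g (h x) y = g x (f y)"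
  shows "tr h = tr f"
proof -
  have bg: "bilinear g" using g by (simp add: inner_product_def)
  have sym: "g x y = g y x" for x y using g by (simp add: inner_product_def)
  have "\<exists>w. \<forall>y. z \<bullet> y = g w y" for z
    using riesz[OF g, of "\<lambda>y. z \<bullet> y"] by (auto simp: linear_iff inner_add_right)
  then obtain R where R: "\<And>z y. z \<bullet> y = g (R z) y" by metis
  have linR: "linear R"
    unfolding linear_iff
    by (intro conjI allI; rule inner_product_cancel[OF g])
      (simp_all add: R[symmetric] bilinear_ladd[OF bg] bilinear_lmul[OF bg] inner_add_left)
  have "\<exists>G. linear G \<and> (\<forall>x. R (G x) = x) \<and> (\<forall>x. G (R x) = x)"
  proof -
    have "inj R" using linear_injective_0[OF linR] R by (metis inner_eq_zero_iff bilinear_lzero[OF bg])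
    from linear_injective_isomorphism[OF linR this] show ?thesis by blast
  qed
  then obtain G where G: "linear G" "\<And>x. R (G x) = x" "\<And>x. G (R x) = x" by blast
  have "f b \<bullet> b = G (h (R b)) \<bullet> b" for b
  proof -
    have "f b \<bullet> b = g (R b) (f b)" by (simp add: R[symmetric] inner_commute)
    also have "\<dots> = G (h (R b)) \<bullet> b" by (simp add: R G a)
    finally show ?thesis .
  qed
  then have "tr f = (\<Sum>b\<in>Basis. G (h (R b)) \<bullet> b)"
    by (simp add: tr_def)
  also have "\<dots> = tr (\<lambda>x. G (h (R x)))" by (simp add: tr_def)
  also have "\<dots> = tr (\<lambda>x. h (R (G x)))"
    using tr_comm[OF G(1) linear_compose[OF linR h]] by (simp add: o_def)
  finally show ?thesis by (simp add: G)
qed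

lemma tr_chain_zero:
  fixes f :: "'a::euclidean_space \<Rightarrow> 'a" and S :: "nat \<Rightarrow> 'a set"
  assumes f: "linear f" and sub: "\<And>n. subspace (S n)" and S0: "S 0 = UNIV"
    and dec: "\<And>n. S (Suc n) \<subseteq> S n" and map: "\<And>n x. x \<in> S n \<Longrightarrow> f x \<in> S (Suc n)"
    and fin: "S m = {0}"
  shows "tr f = 0"
proof -
  have "\<exists>P. linear P \<and> range P \<subseteq> S n \<and> (\<forall>x\<in>S n. P x = x)" for n
  proof -
    obtain B where B: "B \<subseteq> S n" "independent B" "S n \<subseteq> span B"
      using maximal_independent_subset by blast
    obtain P where P: "linear P" "\<forall>x\<in>B. P x = id x" "range P = span (id ` B)"
      using linear_independent_extend_subspace[OF B(2), of id] by blast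
    have "P x = id x" if "x \<in> span B" for x
      using linear_eq_on_span[OF P(1) linear_id _ that] P(2) by auto
    moreover have "span B \<subseteq> S n" using B(1) sub span_minimal by blast
    ultimately have "\<forall>x\<in>S n. P x = x" using B(3) by auto
    with P B \<open>span B \<subseteq> S n\<close> show ?thesis by (intro exI[of _ P]) auto
  qed
  then obtain P where P: "\<And>n. linear (P n)" "\<And>n x. P n x \<in> S n" "\<And>n x. x \<in> S n \<Longrightarrow> P n x = x"
    by (metis rangeI subsetD)
  have "tr f = tr (\<lambda>x. f (P n x))" for n
  proof (induction n)
    case 0
    then show ?case using P(3)[of _ 0] S0 by simp
  next
    case (Suc n)
    have lin: "linear (\<lambda>x. f (P n x))"
      using linear_compose[OF P(1) f] by (simp add: o_def)
    have "tr f = tr (\<lambda>x. P (Suc n) (f (P n x)))"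
      using Suc by (simp add: P map)
    also have "\<dots> = tr (\<lambda>x. f (P n (P (Suc n) x)))"
      using tr_comm[OF P(1) lin] .
    also have "\<dots> = tr (\<lambda>x. f (P (Suc n) x))"
      using P(2)[of "Suc n"] dec[of n] by (simp add: P(3) subset_iff)
    finally show ?case .
  qed
  from this[of m] have "tr f = tr (\<lambda>x. f 0)"
    using P(2)[of m] fin by simp
  then show ?thesis by (simp add: linear_0[OF f] tr_def)
qed

lemma nilpotent_traces:
  fixes br :: "'a::euclidean_space \<Rightarrow> 'a \<Rightarrow> 'a"
  assumes "nilpotent_lie br"
  shows "tr (br u) = 0" and "tr (\<lambda>x. br u (br v x)) = 0"
proof -
  let ?L = "lower_central br"
  obtain m where m: "?L m = {0}" and l: "lie_algebra br"
    using assms by (auto simp: nilpotent_lie_def)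
  have lin: "linear (br u)" for u using l by (simp add: lie_algebra_def bilinear_def)
  have sub: "subspace (?L n)" for n by (cases n) auto
  have step: "br x y \<in> ?L (Suc n)" if "y \<in> ?L n" for x y n
    using that by (auto intro!: span_base)
  have dec: "?L (Suc n) \<subseteq> ?L n" for n
  proof (induction n)
    case (Suc n)
    show ?case
      unfolding lower_central.simps(2)[of br "Suc n"]
      by (rule span_minimal[OF _ sub]) (use Suc step in blast)
  qed simp
  show "tr (br u) = 0"
    using lin sub lower_central.simps(1) dec step m by (rule tr_chain_zero)
  have lin2: "linear (\<lambda>x. br u (br v x))"
    using linear_compose[OF lin[of v] lin[of u]] by (simp add: o_def)
  have step2: "br u (br v x) \<in> ?L (Suc n)" if "x \<in> ?L n" for n x
    using that step dec by blast
  show "tr (\<lambda>x. br u (br v x)) = 0"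
    using lin2 sub lower_central.simps(1) dec step2 m by (rule tr_chain_zero)
qed

text \<open>
  The usual expression for the Ricci tensor of a nilpotent Lie group, with
  \<open>J\<^sub>u w = ad\<^sub>w\<^sup>* u\<close>.
\<close>

lemma ricci_nilpotent:
  fixes br :: "'a::euclidean_space \<Rightarrow> 'a \<Rightarrow> 'a"
  assumes nil: "nilpotent_lie br" and g: "inner_product g"
  defines "J \<equiv> \<lambda>u w. ad_star br g w u"
  shows "ricci br g u v = - 1/2 * tr (br u \<circ> ad_star br g v) - 1/4 * tr (J u \<circ> J v)"
proof -
  have l: "lie_algebra br" using nil by (simp add: nilpotent_lie_def)
  let ?A = "ad_star br g"
  let ?N = "levi_civita br g"
  have bg: "bilinear g" using g by (simp add: inner_product_def)
  have sym: "g x y = g y x" for x y using g by (simp add: inner_product_def)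
  have bb: "bilinear br" using l by (simp add: lie_algebra_def)
  have ba: "bilinear ?A" by (rule bilinear_ad_star[OF g l])
  note ac = lie_anticomm[OF l]
  note gs = bilinear_lneg[OF bg] bilinear_rneg[OF bg] ad_star[OF g l]
  have lin: "linear (br u)" "linear (?A u)" "linear (J u)" for u
    using bb ba by (auto simp: bilinear_def J_def)
  define \<Lambda> where "\<Lambda> x w = (-1/2) *\<^sub>R (br x w + ?A x w + J x w)" for x w
  have lin\<Lambda>: "linear (\<Lambda> x)" for x
    unfolding \<Lambda>_def
    by (rule linearI) (simp_all add: linear_add[OF lin(1)] linear_add[OF lin(2)]
      linear_add[OF lin(3)] linear_scale[OF lin(1)] linear_scale[OF lin(2)]
      linear_scale[OF lin(3)] algebra_simps)
  have N\<Lambda>: "?N w x = \<Lambda> x w" for w x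
    using ac[of w x] by (simp add: levi_civita[OF g l] \<Lambda>_def J_def algebra_simps)
  have N\<Lambda>': "?N x w = br x w + \<Lambda> x w" for x w
  proof -
    have "br x w = (1/2) *\<^sub>R br x w + (1/2) *\<^sub>R br x w" by (simp flip: scaleR_left_distrib)
    then show ?thesis
      by (simp add: levi_civita[OF g l] \<Lambda>_def J_def algebra_simps)
  qed
  have Jskew: "g (J u x) y = - g x (J u y)" for u x y
    unfolding J_def using ac[of x y] sym[of x "?A y u"] by (simp add: gs)
  have trAA: "tr (?A x) = 0" for x
  proof -
    have "tr (?A x) = tr (br x)"
      by (rule tr_g_adjoint[OF g lin(1) lin(2)]) (rule ad_star[OF g l])
    then show ?thesis by (simp add: nilpotent_traces(1)[OF nil])
  qed
  have skew0: "tr h = 0" if "linear h" and h: "\<And>x y. g (h x) y = - g x (h y)" for h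
  proof -
    have "linear (\<lambda>x. - h x)" using that(1) by (simp add: linear_compose_neg)
    moreover have "g (h x) y = g x (- h y)" for x y using h by (simp add: gs)
    ultimately have "tr h = tr (\<lambda>x. - h x)" using tr_g_adjoint[OF g _ that(1)] by blast
    then show ?thesis by (simp add: tr_def sum_negf)
  qed
  have tr\<Lambda>: "tr (\<Lambda> x) = 0" for x
    using trAA[of x] nilpotent_traces(1)[OF nil, of x] skew0[OF lin(3)[of x]] Jskew[of x]
    unfolding \<Lambda>_def tr_scale tr_add by simp
  have "curvature br g w u v =
      \<Lambda> (?N u v) w - (br u (\<Lambda> v w) + \<Lambda> u (\<Lambda> v w)) + \<Lambda> v (br u w)" for w
  proof -
    have "?N (br w u) v = - \<Lambda> v (br u w)"
      by (simp add: N\<Lambda> ac[of w u] linear_neg[OF lin\<Lambda>])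
    then show ?thesis
      by (simp add: curvature_def Let_def N\<Lambda>[of w] N\<Lambda>'[of u "\<Lambda> v w"])
  qed
  then have "ricci br g u v = tr (\<lambda>w. \<Lambda> v (br u w)) - tr (\<lambda>w. br u (\<Lambda> v w)) - tr (\<lambda>w. \<Lambda> u (\<Lambda> v w))"
    by (simp add: ricci_def tr_add tr_diff tr\<Lambda>)
  then have ric: "ricci br g u v = - tr (\<lambda>w. \<Lambda> u (\<Lambda> v w))"
    using tr_comm[OF lin\<Lambda>[of v] lin(1)[of u]] by simp
  have \<Lambda>\<Lambda>: "\<Lambda> u (\<Lambda> v w) = (1/4) *\<^sub>R (br u (br v w) + ?A u (?A v w) + J u (J v w)
      + (br u (?A v w) + ?A u (br v w)) + ((br u (J v w) + ?A u (J v w))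
      + (J u (br v w) + J u (?A v w))))" for w
    unfolding \<Lambda>_def
    by (simp add: linear_add[OF lin(1)] linear_add[OF lin(2)] linear_add[OF lin(3)]
      linear_scale[OF lin(1)] linear_scale[OF lin(2)] linear_scale[OF lin(3)]
      linear_diff[OF lin(1)] linear_diff[OF lin(2)] linear_diff[OF lin(3)]
      linear_neg[OF lin(1)] linear_neg[OF lin(2)] linear_neg[OF lin(3)] algebra_simps)
  have expand: "tr (\<lambda>w. (1/4) *\<^sub>R (br u (br v w) + ?A u (?A v w) + J u (J v w)
      + (br u (?A v w) + ?A u (br v w)) + ((br u (J v w) + ?A u (J v w))
      + (J u (br v w) + J u (?A v w))))) =
    (1/4) * (tr (\<lambda>w. br u (br v w)) + tr (\<lambda>w. ?A u (?A v w)) + tr (\<lambda>w. J u (J v w))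
      + (tr (\<lambda>w. br u (?A v w)) + tr (\<lambda>w. ?A u (br v w)))
      + (tr (\<lambda>w. br u (J v w) + ?A u (J v w)) + tr (\<lambda>w. J u (br v w) + J u (?A v w))))"
    by (simp only: tr_scale tr_add)
  have BB: "tr (\<lambda>w. br u (br v w)) = 0"
    by (rule nilpotent_traces(2)[OF nil])
  have AA: "tr (\<lambda>w. ?A u (?A v w)) = 0"
  proof -
    have "tr (\<lambda>w. ?A u (?A v w)) = tr (\<lambda>w. br v (br u w))"
      by (rule tr_g_adjoint[OF g])
        (use linear_compose[OF lin(1)[of u] lin(1)[of v]] linear_compose[OF lin(2)[of v] lin(2)[of u]]
          in \<open>simp_all add: o_def gs\<close>)
    then show ?thesis by (simp add: nilpotent_traces(2)[OF nil])
  qed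
  have AB: "tr (\<lambda>w. ?A u (br v w)) = tr (\<lambda>w. br u (?A v w))"
  proof -
    have "tr (\<lambda>w. ?A u (br v w)) = tr (\<lambda>w. ?A v (br u w))"
    proof (rule tr_g_adjoint[OF g])
      show "g (?A u (br v x)) y = g x (?A v (br u y))" for x y
        using ad_star[OF g l, of u "br v x" y] ad_star[OF g l, of v "br u y" x]
          sym[of "br v x" "br u y"] sym[of x "?A v (br u y)"] by simp
    qed (use linear_compose[OF lin(1)[of v] lin(2)[of u]] linear_compose[OF lin(1)[of u] lin(2)[of v]] in \<open>simp_all add: o_def\<close>)
    then show ?thesis using tr_comm[OF lin(2)[of v] lin(1)[of u]] by simp
  qed
  have SJ: "tr (\<lambda>w. br u (J v w) + ?A u (J v w)) + tr (\<lambda>w. J u (br v w) + J u (?A v w)) = 0"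
  proof -
    have *: "tr (\<lambda>w. br x (J y w) + ?A x (J y w)) = 0" for x y
    proof -
      have "tr (\<lambda>w. ?A x (J y w)) = tr (\<lambda>w. - J y (br x w))"
      proof (rule tr_g_adjoint[OF g])
        show "linear (\<lambda>w. - J y (br x w))"
          using linear_compose[OF lin(1)[of x] lin(3)[of y]] by (simp add: o_def linear_compose_neg)
        show "linear (\<lambda>w. ?A x (J y w))"
          using linear_compose[OF lin(3)[of y] lin(2)[of x]] by (simp add: o_def)
        show "g (?A x (J y a)) b = g a (- J y (br x b))" for a b
          by (simp add: gs Jskew)
      qed
      also have "\<dots> = - tr (\<lambda>w. br x (J y w))"
        using tr_comm[OF lin(3)[of y] lin(1)[of x]] by (simp add: tr_def sum_negf)
      finally show ?thesis by (simp add: tr_add)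
    qed
    have "tr (\<lambda>w. J u (br v w) + J u (?A v w)) = tr (\<lambda>w. br v (J u w) + ?A v (J u w))"
      using tr_comm[OF lin(3)[of u] lin(1)[of v]] tr_comm[OF lin(3)[of u] lin(2)[of v]]
      by (simp add: tr_add)
    then show ?thesis by (simp add: *)
  qed
  show ?thesis
    unfolding ric \<Lambda>\<Lambda> expand BB AA AB SJ o_def by (simp add: field_simps)
qed

end

theory Submission
  imports Defs
begin

text \<open>
  In an orthonormal frame the Ricci tensor of a nilpotent Lie algebra is a quadratic expression in
  the structure constants. For \<open>A\<^sub>5\<^sub>,\<^sub>2\<close> its only off-diagonal entries are multiples of \<open>\<beta>\<gamma>\<close> and
  \<open>\<alpha>\<beta>\<close>. The \<open>v\<^sub>4\<close>-component of the Leibniz rule for \<open>[v\<^sub>1, v\<^sub>4]\<close> forces \<open>\<beta> = 0\<close>. Then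
  \<open>D = Ric - k Id\<close> is diagonal, and it is a derivation if and only if its entries at \<open>v\<^sub>2, \<dots>, v\<^sub>5\<close> form an
  arithmetic progression whose step is the entry at \<open>v\<^sub>1\<close>. The constant \<open>k\<close> absorbs the step, so
  two linear equations in \<open>\<alpha>\<^sup>2, \<gamma>\<^sup>2, \<delta>\<^sup>2\<close> remain.
\<close>

text \<open>Both sides are linear in \<open>u\<close> and agree on the spanning family. The frame is
  orthonormal for \<open>\<eta> * g\<close>, not for \<open>g\<close>, hence the factor
  \<open>\<eta>\<close> in the Fourier coefficients here and below.\<close>

lemma orthonormal_expansion:
  fixes g :: "'a::real_vector \<Rightarrow> 'a \<Rightarrow> real"
  assumes g: "bilinear g" and fin: "finite I" and sp: "span (v ` I) = UNIV"
    and on: "\<And>i j. i \<in> I \<Longrightarrow> j \<in> I \<Longrightarrow> \<eta> * g (v i) (v j) = (if i = j then 1 else 0)"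
  shows "(\<Sum>i\<in>I. (\<eta> * g u (v i)) *\<^sub>R v i) = u"
proof -
  have "linear (\<lambda>u. \<Sum>i\<in>I. (\<eta> * g u (v i)) *\<^sub>R v i)"
    by (rule linearI)
      (simp_all add: bilinear_ladd[OF g] bilinear_lmul[OF g] algebra_simps sum.distrib
        scaleR_sum_right)
  moreover have "(\<Sum>i\<in>I. (\<eta> * g (v j) (v i)) *\<^sub>R v i) = v j" if "j \<in> I" for j
  proof -
    have "(\<Sum>i\<in>I. (\<eta> * g (v j) (v i)) *\<^sub>R v i) = (\<Sum>i\<in>I. if j = i then v i else 0)"
      by (rule sum.cong) (simp_all add: on that)
    then show ?thesis using fin that by simp
  qed
  ultimately show ?thesis
    using linear_eq_on_span[OF _ linear_ident, of _ "v ` I" u] sp by auto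
qed

text \<open>Frees \<open>tr\<close> from the built-in \<open>Basis\<close>. Expanding
  \<open>f b\<close> along \<open>v\<close> and swapping the sums leaves, for each \<open>i\<close>,
  the \<open>Basis\<close> expansion of \<open>v i\<close> under the linear functional
  \<open>\<phi> i \<circ> f\<close>.\<close>

lemma tr_dual_basis:
  fixes f :: "'a::euclidean_space \<Rightarrow> 'a"
  assumes f: "linear f" and \<phi>: "\<And>i. i \<in> I \<Longrightarrow> linear (\<phi> i)"
    and ex: "\<And>u. (\<Sum>i\<in>I. \<phi> i u *\<^sub>R v i) = u"
  shows "tr f = (\<Sum>i\<in>I. \<phi> i (f (v i)))"
proof -
  have "tr f = (\<Sum>b\<in>Basis. (\<Sum>i\<in>I. \<phi> i (f b) *\<^sub>R v i) \<bullet> b)"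
    by (simp add: tr_def ex)
  also have "\<dots> = (\<Sum>i\<in>I. \<Sum>b\<in>Basis. (v i \<bullet> b) * \<phi> i (f b))"
    by (subst sum.swap) (simp add: inner_sum_left mult.commute)
  also have "\<dots> = (\<Sum>i\<in>I. \<phi> i (f (v i)))"
  proof (rule sum.cong)
    fix i assume "i \<in> I"
    then have l: "linear (\<lambda>x. \<phi> i (f x))" using linear_compose[OF f \<phi>] by (simp add: o_def)
    have "\<phi> i (f (v i)) = \<phi> i (f (\<Sum>b\<in>Basis. (v i \<bullet> b) *\<^sub>R b))"
      by (simp add: euclidean_representation)
    then show "(\<Sum>b\<in>Basis. (v i \<bullet> b) * \<phi> i (f b)) = \<phi> i (f (v i))"
      by (simp add: linear_sum[OF l] linear_scale[OF l])
  qed simp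
  finally show ?thesis .
qed

text \<open>Evaluates both traces of \<open>ricci_nilpotent\<close> in the frame. The adjoints
  disappear, so only structure constants remain.\<close>

lemma ricci_orthonormal:
  fixes br :: "'a::euclidean_space \<Rightarrow> 'a \<Rightarrow> 'a"
  assumes nil: "nilpotent_lie br" and g: "inner_product g"
    and ex: "\<And>u. (\<Sum>i\<in>I. (\<eta> * g u (v i)) *\<^sub>R v i) = u"
  shows "ricci br g u w = - 1/2 * (\<Sum>i\<in>I. \<eta> * g (br u (v i)) (br w (v i)))
    + 1/4 * (\<Sum>i\<in>I. \<Sum>j\<in>I. (\<eta> * g u (br (v i) (v j))) * (\<eta> * g w (br (v i) (v j))))"
proof -
  have l: "lie_algebra br" using nil by (simp add: nilpotent_lie_def)
  have bg: "bilinear g" using g by (simp add: inner_product_def)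
  have sym: "g x y = g y x" for x y using g by (simp add: inner_product_def)
  have bb: "bilinear br" using l by (simp add: lie_algebra_def)
  let ?A = "ad_star br g"
  have ba: "bilinear ?A" by (rule bilinear_ad_star[OF g l])
  have lin: "linear (br u)" "linear (?A u)" "linear (\<lambda>w. ?A w u)" for u
    using bb ba by (auto simp: bilinear_def)
  \<comment> \<open>Parseval's identity; it will turn inner products of adjoints into products of
    structure constants.\<close>
  have pars: "\<eta> * g x y = (\<Sum>i\<in>I. (\<eta> * g x (v i)) * (\<eta> * g y (v i)))" for x y
  proof -
    have lx: "linear (g x)" using bg by (simp add: bilinear_def)
    have "\<eta> * g x y = \<eta> * g x (\<Sum>i\<in>I. (\<eta> * g y (v i)) *\<^sub>R v i)" by (simp add: ex)
    also have "\<dots> = (\<Sum>i\<in>I. (\<eta> * g x (v i)) * (\<eta> * g y (v i)))"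
      by (simp add: linear_sum[OF lx] linear_scale[OF lx] sum_distrib_left algebra_simps)
    finally show ?thesis .
  qed
  have tr: "tr f = (\<Sum>i\<in>I. \<eta> * g (f (v i)) (v i))" if "linear f" for f
  proof (rule tr_dual_basis[OF that _ ex])
    show "linear (\<lambda>u. \<eta> * g u (v i))" for i
      by (rule linearI) (simp_all add: bilinear_ladd[OF bg] bilinear_lmul[OF bg] algebra_simps)
  qed
  \<comment> \<open>Cyclicity puts the adjoint outermost, where pairing with \<open>v i\<close>
    moves it across \<open>g\<close>.\<close>
  have "tr (\<lambda>x. br u (?A w x)) = tr (\<lambda>x. ?A w (br u x))"
    by (rule tr_comm[OF lin(1,2)])
  also have "\<dots> = (\<Sum>i\<in>I. \<eta> * g (br u (v i)) (br w (v i)))"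
    using linear_compose[OF lin(1)[of u] lin(2)[of w]] by (simp add: o_def tr ad_star[OF g l])
  finally have 1: "tr (\<lambda>x. br u (?A w x)) = (\<Sum>i\<in>I. \<eta> * g (br u (v i)) (br w (v i)))" .
  \<comment> \<open>This operator is \<open>J u \<circ> J w\<close>. Skew-symmetry of
    \<open>J u\<close>, a consequence of anticommutativity of the bracket, produces the minus
    sign.\<close>
  have "tr (\<lambda>x. ?A (?A x w) u) = (\<Sum>i\<in>I. \<eta> * g (?A (?A (v i) w) u) (v i))"
    using linear_compose[OF lin(3)[of w] lin(3)[of u]] by (simp add: o_def tr)
  also have "\<dots> = (\<Sum>i\<in>I. - (\<eta> * g (?A (v i) u) (?A (v i) w)))"
  proof (rule sum.cong)
    fix i assume "i \<in> I"
    show "\<eta> * g (?A (?A (v i) w) u) (v i) = - (\<eta> * g (?A (v i) u) (?A (v i) w))"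
      using lie_anticomm[OF l, of "?A (v i) w" "v i"]
      by (simp add: ad_star[OF g l] bilinear_rneg[OF bg])
  qed simp
  also have "\<dots> = - (\<Sum>i\<in>I. \<Sum>j\<in>I. (\<eta> * g u (br (v i) (v j))) * (\<eta> * g w (br (v i) (v j))))"
    by (subst pars) (simp only: ad_star[OF g l] sum_negf)
  finally show ?thesis
    unfolding ricci_nilpotent[OF nil g] o_def 1 by simp
qed

theorem corollary8:
  fixes br :: "'a::euclidean_space \<Rightarrow> 'a \<Rightarrow> 'a"
    and g :: "'a \<Rightarrow> 'a \<Rightarrow> real"
    and v :: "nat \<Rightarrow> 'a"
    and \<eta> \<alpha> \<beta> \<gamma> \<delta> :: real
  assumes "A52 br"
    and "inner_product g"
    and "\<eta> > 0"
    and "basis5 v"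
    and "\<forall>i\<in>{1..5}. \<forall>j\<in>{1..5}. \<eta> * g (v i) (v j) = (if i = j then 1 else 0)"
    and "A52_brackets br v \<alpha> \<beta> \<gamma> \<delta>"
    and "\<alpha> > 0" and "\<gamma> > 0" and "\<delta> > 0"
  shows "nilsoliton br g \<longleftrightarrow> \<beta> = 0 \<and> \<alpha> = \<delta> \<and> \<delta> = sqrt 3 / 2 * \<gamma>"
proof -
  note g = \<open>inner_product g\<close>
  have nil: "nilpotent_lie br" by (rule A52_nilpotent[OF \<open>A52 br\<close>])
  then have l: "lie_algebra br" by (simp add: nilpotent_lie_def)
  have bg: "bilinear g" using g by (simp add: inner_product_def)
  have bb: "bilinear br" using l by (simp add: lie_algebra_def)
  note bs = bilinear_ladd[OF bg] bilinear_radd[OF bg] bilinear_lmul[OF bg] bilinear_rmul[OF bg]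
    bilinear_lneg[OF bg] bilinear_rneg[OF bg] bilinear_lzero[OF bg] bilinear_rzero[OF bg]
    bilinear_lsub[OF bg] bilinear_rsub[OF bg]
  note brs = bilinear_ladd[OF bb] bilinear_radd[OF bb] bilinear_lmul[OF bb] bilinear_rmul[OF bb]
    bilinear_lneg[OF bb] bilinear_rneg[OF bb] bilinear_lzero[OF bb] bilinear_rzero[OF bb]
    bilinear_lsub[OF bb] bilinear_rsub[OF bb]
  have sp: "span (v ` {1..5}) = UNIV" using \<open>basis5 v\<close> by (simp add: basis5_def)
  have ex: "(\<Sum>i\<in>{1..5}. (\<eta> * g u (v i)) *\<^sub>R v i) = u" for u
    by (rule orthonormal_expansion[OF bg _ sp]) (use assms(5) in auto)
  define a b c d e where "a = v 1" and "b = v 2" and "c = v 3" and "d = v 4" and "e = v 5"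
  note v = a_def[symmetric] b_def[symmetric] c_def[symmetric] d_def[symmetric] e_def[symmetric]
  have ball5: "(\<forall>i\<in>{1..5::nat}. P i) \<longleftrightarrow> P 1 \<and> P 2 \<and> P 3 \<and> P 4 \<and> P 5" for P
    unfolding set15 by blast
  have sum5: "sum f {1..5::nat} = f 1 + f 2 + f 3 + f 4 + f 5" for f :: "nat \<Rightarrow> 'b::ab_group_add"
    unfolding set15 by (simp add: add.assoc)
  have G: "g a a = 1/\<eta>" "g b b = 1/\<eta>" "g c c = 1/\<eta>" "g d d = 1/\<eta>" "g e e = 1/\<eta>"
    "g a b = 0" "g a c = 0" "g a d = 0" "g a e = 0"
    "g b a = 0" "g b c = 0" "g b d = 0" "g b e = 0"
    "g c a = 0" "g c b = 0" "g c d = 0" "g c e = 0"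
    "g d a = 0" "g d b = 0" "g d c = 0" "g d e = 0"
    "g e a = 0" "g e b = 0" "g e c = 0" "g e d = 0"
    using assms(5) \<open>\<eta> > 0\<close> unfolding ball5 v by (simp_all add: field_simps)
  have B0: "br a b = \<alpha> *\<^sub>R c + \<beta> *\<^sub>R d" "br a c = \<gamma> *\<^sub>R d" "br a d = \<delta> *\<^sub>R e" "br a e = 0"
    "br b b = 0" "br b c = 0" "br b d = 0" "br b e = 0"
    "br c b = 0" "br c c = 0" "br c d = 0" "br c e = 0"
    "br d b = 0" "br d c = 0" "br d d = 0" "br d e = 0"
    "br e b = 0" "br e c = 0" "br e d = 0" "br e e = 0" "br a a = 0"
    using assms(6) l unfolding A52_brackets_def set15 ball_simps v lie_algebra_def by simp_all
  have B: "br b a = - (\<alpha> *\<^sub>R c + \<beta> *\<^sub>R d)" "br c a = - (\<gamma> *\<^sub>R d)" "br d a = - (\<delta> *\<^sub>R e)" "br e a = 0"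
    using lie_anticomm[OF l, of _ a] by (simp_all add: B0)
  note ric = ricci_orthonormal[OF nil g ex]
  have op: "ricci_op br g u = \<eta> *\<^sub>R (ricci br g u a *\<^sub>R a + ricci br g u b *\<^sub>R b + ricci br g u c *\<^sub>R c
      + ricci br g u d *\<^sub>R d + ricci br g u e *\<^sub>R e)" for u
    using ex[of "ricci_op br g u"] unfolding sum5 v
    by (simp add: ricci_op[OF g l, symmetric] algebra_simps)
  \<comment> \<open>Needed for the converse, where the derivation is built from
    \<open>ricci_op\<close>.\<close>
  have lin: "linear (ricci_op br g)"
  proof -
    have "linear (\<lambda>u. ricci br g u w)" for w
      unfolding ric sum5 by (rule linearI) (simp_all add: bs brs algebra_simps)
    note lr = linear_add[OF this] linear_scale[OF this]
    show ?thesis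
      unfolding op by (rule linearI) (simp_all add: lr algebra_simps)
  qed
  \<comment> \<open>On the diagonal, a frame vector collects \<open>- \<eta>/2\<close> times the
    squared coefficients of the brackets it enters, and \<open>\<eta>/2\<close> times its own
    squared coefficients in brackets that produce it.\<close>
  have R: "ricci_op br g a = (- \<eta>/2 * (\<alpha>^2 + \<beta>^2 + \<gamma>^2 + \<delta>^2)) *\<^sub>R a"
    "ricci_op br g b = (- \<eta>/2 * (\<alpha>^2 + \<beta>^2)) *\<^sub>R b - (\<eta>/2 * \<beta> * \<gamma>) *\<^sub>R c"
    "ricci_op br g c = (\<eta>/2 * (\<alpha>^2 - \<gamma>^2)) *\<^sub>R c - (\<eta>/2 * \<beta> * \<gamma>) *\<^sub>R b + (\<eta>/2 * \<alpha> * \<beta>) *\<^sub>R d"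
    "ricci_op br g d = (\<eta>/2 * (\<beta>^2 + \<gamma>^2 - \<delta>^2)) *\<^sub>R d + (\<eta>/2 * \<alpha> * \<beta>) *\<^sub>R c"
    "ricci_op br g e = (\<eta>/2 * \<delta>^2) *\<^sub>R e"
    using \<open>\<eta> > 0\<close> unfolding op ric sum5 v
    by (simp_all add: B0 B bs G field_simps power2_eq_square)
  show ?thesis
  proof
    assume "nilsoliton br g"
    then obtain k D where der: "derivation br D" and kD: "\<And>u. ricci_op br g u = k *\<^sub>R u + D u"
      by (auto simp: nilsoliton_def)
    have D: "D u = ricci_op br g u - k *\<^sub>R u" for u by (simp add: kD)
    have ld: "linear D" and leib: "\<And>x y. D (br x y) = br (D x) y + br x (D y)"
      using der by (auto simp: derivation_def)
    note ls = linear_add[OF ld] linear_scale[OF ld]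
    \<comment> \<open>\<open>D e\<close> and \<open>br (D a) d\<close> are multiples of
      \<open>e\<close>, hence orthogonal to \<open>d\<close>. Only the \<open>c\<close>-part of
      \<open>D d\<close> survives, through \<open>br a c\<close>, leaving a nonzero multiple of
      \<open>\<alpha> * \<beta> * \<gamma>\<close>.\<close>
    have "g (D (br a d)) d = g (br (D a) d + br a (D d)) d"
      by (simp only: leib)
    then have "\<beta> = 0"
      using assms(3,7-9) unfolding B0 ls D[of a] D[of d] D[of e] R
      by (simp add: B0 bs brs G)
    \<comment> \<open>The eigenvalues of \<open>D\<close> once \<beta> vanishes.\<close>
    define p q r s t where pqrst: "p = - \<eta>/2 * (\<alpha>^2 + \<gamma>^2 + \<delta>^2) - k" "q = - \<eta>/2 * \<alpha>^2 - k"
      "r = \<eta>/2 * (\<alpha>^2 - \<gamma>^2) - k" "s = \<eta>/2 * (\<gamma>^2 - \<delta>^2) - k" "t = \<eta>/2 * \<delta>^2 - k"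
    have DR: "D a = p *\<^sub>R a" "D b = q *\<^sub>R b" "D c = r *\<^sub>R c" "D d = s *\<^sub>R d" "D e = t *\<^sub>R e"
      unfolding D R \<open>\<beta> = 0\<close> pqrst by (simp_all add: scaleR_left_diff_distrib)
    \<comment> \<open>A bracket of eigenvectors has the sum of their eigenvalues; each pairing
      selects the only surviving coordinate.\<close>
    have "g (D (br a d)) e = g (br (D a) d + br a (D d)) e"
      "g (D (br a c)) d = g (br (D a) c + br a (D c)) d"
      "g (D (br a b)) c = g (br (D a) b + br a (D b)) c"
      by (simp_all only: leib)
    then have "\<delta> * t = \<delta> * (p + s)" "\<gamma> * s = \<gamma> * (p + r)" "\<alpha> * r = \<alpha> * (p + q)"
      using assms(3) unfolding B0 ls DR \<open>\<beta> = 0\<close>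
      by (simp_all add: B0 bs brs G DR \<open>\<beta> = 0\<close> add_divide_distrib[symmetric] algebra_simps)
    then have "t - s = p" "s - r = p" "r - q = p" using assms(7-9) by simp_all
    \<comment> \<open>Eliminating \<open>p\<close> also eliminates \<open>k\<close>, which cancels
      in these differences.\<close>
    then have "t - s = r - q" "s - r = r - q" by simp_all
    then have "\<eta> * (2 * \<delta>^2 - \<gamma>^2) = \<eta> * (2 * \<alpha>^2 - \<gamma>^2)"
      "\<eta> * (2 * \<gamma>^2 - \<delta>^2 - \<alpha>^2) = \<eta> * (2 * \<alpha>^2 - \<gamma>^2)"
      unfolding pqrst by (simp_all add: field_simps)
    then have sq: "\<delta>^2 = \<alpha>^2" "\<alpha>^2 = 3/4 * \<gamma>^2"
      using \<open>\<eta> > 0\<close> by simp_all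
    have "\<alpha> = \<delta>" using sq(1) assms(7,9) by (simp add: power2_eq_iff)
    moreover have "\<alpha>^2 = (sqrt 3 / 2 * \<gamma>)^2"
      by (simp add: sq(2) power_mult_distrib power_divide)
    then have "\<alpha> = sqrt 3 / 2 * \<gamma>"
      using assms(7,8) by (simp add: power2_eq_iff_nonneg)
    ultimately show "\<beta> = 0 \<and> \<alpha> = \<delta> \<and> \<delta> = sqrt 3 / 2 * \<gamma>"
      using \<open>\<beta> = 0\<close> by simp
  next
    assume *: "\<beta> = 0 \<and> \<alpha> = \<delta> \<and> \<delta> = sqrt 3 / 2 * \<gamma>"
    then have "\<beta> = 0" "\<alpha> = \<delta>" "\<delta>^2 = (sqrt 3 / 2 * \<gamma>)^2" by blast+
    then have sq: "\<alpha>^2 = 3/4 * \<gamma>^2" "\<delta>^2 = 3/4 * \<gamma>^2"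
      unfolding power_mult_distrib power_divide by simp_all
    \<comment> \<open>The solution of \<open>p = r - q\<close> for \<open>k\<close> when \<alpha>,
      \<delta> have the prescribed values.\<close>
    define k where "k = - 3/2 * \<eta> * \<gamma>^2"
    define D where "D u = ricci_op br g u - k *\<^sub>R u" for u
    have ld: "linear D"
      unfolding D_def by (intro linear_compose_sub lin linear_scaleR)
    note ls = linear_add[OF ld] linear_scale[OF ld] linear_neg[OF ld] linear_0[OF ld]
    \<comment> \<open>The eigenvalues 9/8, 11/8, 13/8, 15/8 (times
      \<open>\<eta> * \<gamma>^2\<close>) increase by 1/4, the eigenvalue at
      \<open>a\<close>.\<close>
    have DR: "D a = (\<eta>/4 * \<gamma>^2) *\<^sub>R a" "D b = (9/8 * \<eta> * \<gamma>^2) *\<^sub>R b"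
      "D c = (11/8 * \<eta> * \<gamma>^2) *\<^sub>R c" "D d = (13/8 * \<eta> * \<gamma>^2) *\<^sub>R d"
      "D e = (15/8 * \<eta> * \<gamma>^2) *\<^sub>R e"
      unfolding D_def R \<open>\<beta> = 0\<close> sq k_def by (simp_all add: algebra_simps flip: scaleR_left_distrib scaleR_left_diff_distrib)
    \<comment> \<open>Both sides of the Leibniz rule are bilinear, so checking it on frame pairs
      suffices.\<close>
    have "bilinear (\<lambda>x y. D (br x y))" "bilinear (\<lambda>x y. br (D x) y + br x (D y))"
      unfolding bilinear_def by (auto intro!: linearI simp: brs ls algebra_simps)
    moreover have "\<forall>x\<in>{a,b,c,d,e}. \<forall>y\<in>{a,b,c,d,e}. D (br x y) = br (D x) y + br x (D y)"
      by (simp add: B0 B DR ls brs \<open>\<beta> = 0\<close>)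
        (simp add: algebra_simps flip: scaleR_left_distrib scaleR_left_diff_distrib scaleR_minus_left)
    moreover have "span {a,b,c,d,e} = UNIV"
      using sp unfolding set15 by (simp add: v[unfolded One_nat_def])
    ultimately have "D (br x y) = br (D x) y + br x (D y)" for x y
      using bilinear_eq[of _ _ UNIV "{a,b,c,d,e}" UNIV "{a,b,c,d,e}"] by blast
    then have "derivation br D" using ld by (simp add: derivation_def)
    moreover have "ricci_op br g u = k *\<^sub>R u + D u" for u by (simp add: D_def)
    ultimately show "nilsoliton br g" unfolding nilsoliton_def by blast
  qed
qed

end
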